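(* Let $n\ge 1$, let $A$ be an $n\times n$ complex matrix, let $\mathbf{x}=(x_1,\dots,x_n)^T\in V$ and put $\mathbf{b}=A\mathbf{x}$. Let $1\le j\le n$ and let $A_j$ be the matrix whose columns are identical to the columns of $A$, except that the $j$th column of $A_j$ is $\mathbf{b}$. Then $$\hat e^{\,j}\cdot\Big(\big(S_{n-1}\circ (R_{A_j})^{\otimes (n-1)}\circ T_1\big)(A_j\hat e_j)\Big)\;=\;(-1)^{\lfloor n/2\rfloor}\,(n-1)!\,\det(A)\,x_j ,$$ where $\hat e^{\,j}\cdot u$ denotes the $j$th coordinate of $u\in V$.
   Context: $V=\mathbb{C}^n$ is the space of column vectors with standard basis $\hat e_1,\dots,\hat e_n$, and $V^*$ is the space of row vectors of length $n$ with dual basis $\hat e^1,\dots,\hat e^n$. An $n\times n$ matrix $M$ acts on $V$ by $v\mapsto Mv$, and $R_M:V^*\to V^*$ denotes $w\mapsto wM$ (a matrix on a strand directed from top to bottom in a diagram). For $0\le k\le n$, $T_k:V^{\otimes k}\to (V^* )^{\otimes (n-k)}$ is the function of the trace diagram with a single sink vertex of degree $n$ with $k$ input strands below and $n-k$ output strands above (edges ordered counterclockwise starting from the left), i.e. the linear map $$T_k(v_1\otimes\cdots\otimes v_k)=\sum_{i_1,\dots,i_{n-k}=1}^n \det[v_1\ \cdots\ v_k\ \hat e_{i_{n-k}}\ \cdots\ \hat e_{i_1}]\ \hat e^{i_1}\otimes\cdots\otimes \hat e^{i_{n-k}}.$$ Likewise $S_k:(V^* )^{\otimes k}\to V^{\otimes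 (n-k)}$ is the function of the corresponding diagram with a source vertex: $$S_k(w_1\otimes\cdots\otimes w_k)=\sum_{i_1,\dots,i_{n-k}=1}^n \det\big(\text{matrix with rows } w_1,\dots,w_k,\hat e^{i_{n-k}},\dots,\hat e^{i_1}\big)\ \hat e_{i_1}\otimes\cdots\otimes \hat e_{i_{n-k}}.$$ Vertical stacking of diagrams is composition of functions. The left side is the value of the diagram in which a strand labelled $A_j$ carries the input $\hat e_j$ up into a sink vertex, $n-1$ strands, each labelled $A_j$, run from a source vertex above down to the sink vertex, and the strand leaving the source vertex at the top is paired with $\hat e^{\,j}$. *)

theory Defs
  imports Complex_Main "Jordan_Normal_Form.Determinant"
begin

text \<open>Coordinates are numbered from \<open>0\<close>, so \<open>unit_vec n i\<close> with \<open>i < n\<close> is the \<open>(i+1)\<close>-st basis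
  vector. Column vectors and row vectors of length \<open>n\<close> are both elements of \<open>carrier_vec n\<close>.

  A tensor of order \<open>k\<close>, over column vectors or over row vectors, is given by its coordinates with
  respect to the products of standard (dual) basis vectors. It is a function on multi-indices
  that vanishes outside \<open>multi_idx n k\<close>.\<close>

type_synonym tensor = "nat list \<Rightarrow> complex"

definition multi_idx :: "nat \<Rightarrow> nat \<Rightarrow> nat list set" where
  "multi_idx n k = {I. length I = k \<and> set I \<subseteq> {..<n}}"

definition pure_tensor :: "nat \<Rightarrow> complex vec list \<Rightarrow> tensor" where
  "pure_tensor n vs = (\<lambda>I. if I \<in> multi_idx n (length vs)
     then prod_list (map2 vec_index vs I) else 0)"

text \<open>The linear map whose value on a product of \<open>k\<close> basis vectors is that of \<open>F\<close>. If \<open>F\<close> is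
  multilinear this is its unique linear extension; see \<open>lin_ext_pure_tensor\<close>.\<close>

definition lin_ext :: "nat \<Rightarrow> nat \<Rightarrow> (complex vec list \<Rightarrow> tensor) \<Rightarrow> tensor \<Rightarrow> tensor" where
  "lin_ext n k F t = (\<lambda>I. \<Sum>J\<in>multi_idx n k. t J * F (map (unit_vec n) J) I)"

definition sink_form :: "nat \<Rightarrow> complex vec list \<Rightarrow> tensor" where
  "sink_form n vs = (\<lambda>L. \<Sum>I\<in>multi_idx n (n - length vs).
     det (mat_of_cols n (vs @ map (unit_vec n) (rev I))) * pure_tensor n (map (unit_vec n) I) L)"

definition source_form :: "nat \<Rightarrow> complex vec list \<Rightarrow> tensor" where
  "source_form n ws = (\<lambda>L. \<Sum>I\<in>multi_idx n (n - length ws).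
     det (mat_of_rows n (ws @ map (unit_vec n) (rev I))) * pure_tensor n (map (unit_vec n) I) L)"

definition T_map :: "nat \<Rightarrow> nat \<Rightarrow> tensor \<Rightarrow> tensor" where
  "T_map n k = lin_ext n k (sink_form n)"

definition S_map :: "nat \<Rightarrow> nat \<Rightarrow> tensor \<Rightarrow> tensor" where
  "S_map n k = lin_ext n k (source_form n)"

text \<open>The row vector \<open>w M\<close>.\<close>

definition R_map :: "complex mat \<Rightarrow> complex vec \<Rightarrow> complex vec" where
  "R_map M w = vec (dim_col M) (\<lambda>j. w \<bullet> col M j)"

definition tensor_power :: "nat \<Rightarrow> nat \<Rightarrow> (complex vec \<Rightarrow> complex vec) \<Rightarrow> tensor \<Rightarrow> tensor" where
  "tensor_power n k f = lin_ext n k (\<lambda>ws. pure_tensor n (map f ws))"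

text \<open>The identification of tensors of order \<open>1\<close> with vectors.\<close>

definition vec_to_tensor :: "nat \<Rightarrow> complex vec \<Rightarrow> tensor" where
  "vec_to_tensor n v = pure_tensor n [v]"

definition tensor_to_vec :: "nat \<Rightarrow> tensor \<Rightarrow> complex vec" where
  "tensor_to_vec n t = vec n (\<lambda>i. t [i])"

lemma tensor_to_vec_to_tensor:
  assumes "v \<in> carrier_vec n"
  shows "tensor_to_vec n (vec_to_tensor n v) = v"
  using assms by (intro eq_vecI)
    (auto simp: tensor_to_vec_def vec_to_tensor_def pure_tensor_def multi_idx_def)

lemma vec_to_tensor_to_vec:
  assumes "\<And>I. I \<notin> multi_idx n 1 \<Longrightarrow> t I = 0"
  shows "vec_to_tensor n (tensor_to_vec n t) = t"
proof
  fix I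
  show "vec_to_tensor n (tensor_to_vec n t) I = t I"
  proof (cases "I \<in> multi_idx n 1")
    case True
    then obtain i where "I = [i]" "i < n"
      by (auto simp: multi_idx_def length_Suc_conv)
    then show ?thesis
      by (simp add: tensor_to_vec_def vec_to_tensor_def pure_tensor_def multi_idx_def)
  next
    case False
    then show ?thesis
      using assms by (simp add: vec_to_tensor_def pure_tensor_def)
  qed
qed

lemma multi_idx_0: "multi_idx n 0 = {[]}"
  by (auto simp: multi_idx_def)

lemma multi_idx_Suc: "multi_idx n (Suc k) = (\<lambda>(i, J). i # J) ` ({..<n} \<times> multi_idx n k)"
  by (force simp: multi_idx_def image_iff length_Suc_conv)

lemma finite_multi_idx: "finite (multi_idx n k)"
  by (induction k) (auto simp: multi_idx_0 multi_idx_Suc)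

lemma sum_multi_idx_Suc:
  "(\<Sum>J\<in>multi_idx n (Suc k). g J) = (\<Sum>i<n. \<Sum>J\<in>multi_idx n k. g (i # J))"
proof -
  have "inj_on (\<lambda>(i, J). i # J) ({..<n} \<times> multi_idx n k)"
    by (auto simp: inj_on_def)
  then show ?thesis
    by (simp add: multi_idx_Suc sum.reindex sum.cartesian_product case_prod_beta' o_def)
qed

text \<open>Linearity in each argument, expressed by expansion in the standard basis.\<close>

definition multilinear :: "nat \<Rightarrow> nat \<Rightarrow> (complex vec list \<Rightarrow> complex) \<Rightarrow> bool" where
  "multilinear n k F \<longleftrightarrow>
     (\<forall>us v ws. set us \<subseteq> carrier_vec n \<and> v \<in> carrier_vec n \<and> set ws \<subseteq> carrier_vec n \<and>
        length us + 1 + length ws = k \<longrightarrow>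
        F (us @ v # ws) = (\<Sum>i<n. v $ i * F (us @ unit_vec n i # ws)))"

lemma multilinear_expand:
  assumes F: "multilinear n k F"
    and "set us \<subseteq> carrier_vec n" "set vs \<subseteq> carrier_vec n" "length us + length vs = k"
  shows "F (us @ vs) = (\<Sum>J\<in>multi_idx n (length vs).
    prod_list (map2 vec_index vs J) * F (us @ map (unit_vec n) J))"
  using assms(2-)
proof (induction vs arbitrary: us)
  case Nil
  then show ?case by (simp add: multi_idx_0)
next
  case (Cons v vs)
  have "F (us @ v # vs) = (\<Sum>i<n. v $ i * F ((us @ [unit_vec n i]) @ vs))"
    using F Cons.prems by (simp add: multilinear_def)
  also have "\<dots> = (\<Sum>i<n. v $ i * (\<Sum>J\<in>multi_idx n (length vs).
    prod_list (map2 vec_index vs J) * F ((us @ [unit_vec n i]) @ map (unit_vec n) J)))"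
    by (intro sum.cong refl arg_cong2[where f = "(*)"] Cons.IH) (use Cons.prems in auto)
  finally show ?case
    by (simp add: sum_multi_idx_Suc sum_distrib_left mult.assoc)
qed

lemma lin_ext_pure_tensor:
  assumes "\<And>I. multilinear n k (\<lambda>vs. F vs I)" "set vs \<subseteq> carrier_vec n" "length vs = k"
  shows "lin_ext n k F (pure_tensor n vs) = F vs"
proof
  fix I
  show "lin_ext n k F (pure_tensor n vs) I = F vs I"
    using multilinear_expand[OF assms(1)[of I], of "[]" vs] assms(2,3)
    by (simp add: lin_ext_def pure_tensor_def)
qed

lemma multilinear_det_cols:
  assumes "length zs = n - k" "k \<le> n"
  shows "multilinear n k (\<lambda>vs. det (mat_of_cols n (vs @ zs)))"
  unfolding multilinear_def
proof (intro allI impI, elim conjE)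
  fix us ws :: "complex vec list" and v :: "complex vec"
  assume v: "v \<in> carrier_vec n" and len: "length us + 1 + length ws = k"
  define M where "M v = mat_of_cols n ((us @ v # ws) @ zs)" for v
  define c where "c = length us"
  have c: "c < n" using len assms by (simp add: c_def)
  have car: "M u \<in> carrier_mat n n" for u
    using len assms unfolding M_def by (intro carrier_matI) auto
  have ent: "M u $$ (i, c) = u $ i" if "i < n" for i u
    using that len assms by (simp add: M_def c_def mat_of_cols_index nth_append)
  have del: "mat_delete (M u) i c = mat_delete (M u') i c" if "i < n" for i u u'
  proof -
    have "M u $$ (a, b) = M u' $$ (a, b)" if "a < n" "b < n" "b \<noteq> c" for a b
      using that len assms
      by (cases "b - length us") (auto simp: M_def c_def mat_of_cols_index nth_append)
    then show ?thesis
      using car[of u] car[of u'] that c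
      unfolding mat_delete_def by (intro eq_matI) auto
  qed
  have cof: "cofactor (M u) i c = cofactor (M v) i c" if "i < n" for i u
    using del[OF that, of u v] by (simp add: cofactor_def)
  have lap: "det (M u) = (\<Sum>i<n. u $ i * cofactor (M v) i c)" for u
    unfolding laplace_expansion_column[OF car c, of u]
    by (intro sum.cong refl arg_cong2[where f = "(*)"] cof) (auto simp: ent)
  have "det (M (unit_vec n i)) = cofactor (M v) i c" if "i < n" for i
  proof -
    have "det (M (unit_vec n i)) = (\<Sum>l<n. if l = i then cofactor (M v) l c else 0)"
      unfolding lap by (intro sum.cong) (use that in auto)
    then show ?thesis using that by simp
  qed
  then have "det (M v) = (\<Sum>i<n. v $ i * det (M (unit_vec n i)))"
    by (simp add: lap[of v])
  then show "det (mat_of_cols n ((us @ v # ws) @ zs)) =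
      (\<Sum>i<n. v $ i * det (mat_of_cols n ((us @ unit_vec n i # ws) @ zs)))"
    by (simp add: M_def)
qed

lemma det_mat_of_rows:
  assumes "length vs = n"
  shows "det (mat_of_rows n vs) = det (mat_of_cols n vs)"
proof -
  have "mat_of_rows n vs \<in> carrier_mat n n" using assms by (intro carrier_matI) auto
  from det_transpose[OF this] show ?thesis by (simp add: transpose_mat_of_rows)
qed

lemma source_form_eq_sink_form:
  assumes "length vs \<le> n"
  shows "source_form n vs = sink_form n vs"
  unfolding source_form_def sink_form_def
  by (intro ext sum.cong refl arg_cong2[where f = "(*)"] det_mat_of_rows)
     (use assms in \<open>auto simp: multi_idx_def\<close>)

lemma multilinear_sink_form:
  assumes "k \<le> n"
  shows "multilinear n k (\<lambda>vs. sink_form n vs L)"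
  unfolding multilinear_def
proof (intro allI impI)
  fix us ws :: "complex vec list" and v :: "complex vec"
  assume *: "set us \<subseteq> carrier_vec n \<and> v \<in> carrier_vec n \<and> set ws \<subseteq> carrier_vec n \<and>
    length us + 1 + length ws = k"
  then have len: "length (us @ u # ws) = k" for u by simp
  have "det (mat_of_cols n ((us @ v # ws) @ map (unit_vec n) (rev I))) = 
    (\<Sum>i<n. v $ i * det (mat_of_cols n ((us @ unit_vec n i # ws) @ map (unit_vec n) (rev I))))"
    if "I \<in> multi_idx n (n - k)" for I
    using multilinear_det_cols[of "map (unit_vec n) (rev I)" n k] assms * that
    by (simp add: multilinear_def multi_idx_def)
  then have "sink_form n (us @ v # ws) L = (\<Sum>I\<in>multi_idx n (n - k).
    \<Sum>i<n. v $ i * (det (mat_of_cols n ((us @ unit_vec n i # ws) @ map (unit_vec n) (rev I)))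
       * pure_tensor n (map (unit_vec n) I) L))"
    unfolding sink_form_def len
    by (intro sum.cong refl) (simp add: sum_distrib_right mult.assoc)
  also have "\<dots> = (\<Sum>i<n. v $ i * sink_form n (us @ unit_vec n i # ws) L)"
    unfolding sink_form_def len by (subst sum.swap) (simp add: sum_distrib_left)
  finally show "sink_form n (us @ v # ws) L =
    (\<Sum>i<n. v $ i * sink_form n (us @ unit_vec n i # ws) L)" .
qed

lemma T_map_pure_tensor:
  assumes "k \<le> n" "set vs \<subseteq> carrier_vec n" "length vs = k"
  shows "T_map n k (pure_tensor n vs) = (\<lambda>L. \<Sum>I\<in>multi_idx n (n - k).
    det (mat_of_cols n (vs @ map (unit_vec n) (rev I))) * pure_tensor n (map (unit_vec n) I) L)"
  using lin_ext_pure_tensor[where F = "sink_form n", OF multilinear_sink_form[OF assms(1)] assms(2,3)]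
    assms(3)
  by (simp add: T_map_def sink_form_def)

lemma S_map_pure_tensor:
  assumes "k \<le> n" "set ws \<subseteq> carrier_vec n" "length ws = k"
  shows "S_map n k (pure_tensor n ws) = (\<lambda>L. \<Sum>I\<in>multi_idx n (n - k).
    det (mat_of_rows n (ws @ map (unit_vec n) (rev I))) * pure_tensor n (map (unit_vec n) I) L)"
proof -
  have "multilinear n k (\<lambda>vs. source_form n vs L)" for L
    using multilinear_sink_form[OF assms(1), of L] assms(1)
    by (simp add: multilinear_def source_form_eq_sink_form)
  from lin_ext_pure_tensor[where F = "source_form n", OF this assms(2,3)] show ?thesis
    using assms(3) by (simp add: S_map_def source_form_def)
qed

lemma R_map_expand:
  assumes "M \<in> carrier_mat n n" "w \<in> carrier_vec n" "l < n"
  shows "R_map M w $ l = (\<Sum>i<n. w $ i * R_map M (unit_vec n i) $ l)"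
  using assms by (simp add: R_map_def scalar_prod_def lessThan_atLeast0 sum.delta
      if_distrib[where f = "\<lambda>x. x * _"] cong: if_cong)

lemma tensor_power_R_map_pure_tensor:
  assumes M: "M \<in> carrier_mat n n" and "set ws \<subseteq> carrier_vec n" "length ws = k"
  shows "tensor_power n k (R_map M) (pure_tensor n ws) = pure_tensor n (map (R_map M) ws)"
proof -
  have "multilinear n k (\<lambda>ws. pure_tensor n (map (R_map M) ws) L)" for L
    unfolding multilinear_def
  proof (intro allI impI)
    fix us ws :: "complex vec list" and v :: "complex vec"
    assume *: "set us \<subseteq> carrier_vec n \<and> v \<in> carrier_vec n \<and> set ws \<subseteq> carrier_vec n \<and>
      length us + 1 + length ws = k"
    show "pure_tensor n (map (R_map M) (us @ v # ws)) L =
      (\<Sum>i<n. v $ i * pure_tensor n (map (R_map M) (us @ unit_vec n i # ws)) L)"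
    proof (cases "L \<in> multi_idx n k")
      case False
      then show ?thesis using * by (simp add: pure_tensor_def)
    next
      case True
      then have "length us < length L" using * by (simp add: multi_idx_def)
      then have "L = take (length us) L @ L ! length us # drop (Suc (length us)) L"
        by (rule id_take_nth_drop)
      then obtain L1 l L2 where L: "L = L1 @ l # L2" "length L1 = length us"
        using \<open>length us < length L\<close> by (metis length_take min.absorb4)
      have l: "l < n" using True L by (simp add: multi_idx_def)
      have val: "pure_tensor n (map (R_map M) (us @ u # ws)) L =
        prod_list (map2 vec_index (map (R_map M) us) L1) *
        (R_map M u $ l * prod_list (map2 vec_index (map (R_map M) ws) L2))" for u
        using True * L by (simp add: pure_tensor_def)
      have "R_map M v $ l = (\<Sum>i<n. v $ i * R_map M (unit_vec n i) $ l)"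
        using R_map_expand[OF M _ l] * by blast
      then show ?thesis
        unfolding val by (simp add: sum_distrib_left sum_distrib_right mult_ac)
    qed
  qed
  from lin_ext_pure_tensor[OF this assms(2,3)] show ?thesis
    by (simp add: tensor_power_def)
qed

end

theory Submission
  imports Defs
begin

text \<open>Write \<open>\<epsilon> J\<close> for the determinant of the matrix with columns \<open>e\<^bsub>J\<^sub>1\<^esub>, \<dots>, e\<^bsub>J\<^sub>n\<^esub>\<close> and \<open>M\<close> for
  \<open>A\<^sub>j\<close>. The value of the diagram is
  \<open>\<Sum>I. \<Sum>i. M\<^sub>i\<^sub>j \<epsilon> (i # rev I) det (rows M\<^sub>I, e\<^sub>j)\<close>. Reversal contributes the sign
  \<open>(-1) ^ (n div 2)\<close>. If \<open>\<epsilon> (I @ [i])\<close> is nonzero then \<open>i\<close> does not occur in \<open>I\<close>, so the second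
  determinant is \<open>\<epsilon> (I @ [i])\<close> times the cofactor of \<open>M\<close> at \<open>(i, j)\<close>. As \<open>\<epsilon> (I @ [i])\<^sup>2 = 1\<close> for
  exactly \<open>(n - 1)!\<close> lists \<open>I\<close>, Laplace expansion gives \<open>(n - 1)! det M\<close>, and Cramer's rule
  concludes.\<close>

section \<open>Determinants of matrices of standard basis vectors\<close>

definition levi_civita :: "nat \<Rightarrow> nat list \<Rightarrow> 'a :: comm_ring_1" where
  "levi_civita n J = det (mat_of_cols n (map (unit_vec n) J))"

lemma levi_civita_rows:
  assumes "length J = n"
  shows "levi_civita n J = det (mat_of_rows n (map (unit_vec n) J))"
proof -
  have "mat_of_rows n (map (unit_vec n) J) \<in> carrier_mat n n"
    using assms by (intro carrier_matI) auto
  from det_transpose[OF this] show ?thesis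
    by (simp add: transpose_mat_of_rows levi_civita_def)
qed

text \<open>Selecting rows along \<open>J\<close>, possibly with repetitions, is left multiplication
  by the matrix with rows \<open>unit_vec n (J ! r)\<close>, so \<open>det_mult\<close>
  applies.\<close>

lemma det_rows_reindex:
  fixes N :: "'a :: comm_ring_1 mat"
  assumes N: "N \<in> carrier_mat n n" and J: "J \<in> multi_idx n n"
  shows "det (mat_of_rows n (map (row N) J)) = levi_civita n J * det N"
proof -
  let ?E = "mat_of_rows n (map (unit_vec n) J) :: 'a mat"
  have len: "length J = n" and sub: "\<And>i. i < n \<Longrightarrow> J ! i < n"
    using J nth_mem by (auto simp: multi_idx_def)
  have E: "?E \<in> carrier_mat n n" using len by (intro carrier_matI) auto
  have "mat_of_rows n (map (row N) J) = ?E * N"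
  proof (rule eq_matI)
    fix i c assume "i < dim_row (?E * N)" "c < dim_col (?E * N)"
    then have ic: "i < n" "c < n" using len N by auto
    then show "mat_of_rows n (map (row N) J) $$ (i, c) = (?E * N) $$ (i, c)"
      using len N sub[OF ic(1)] by (simp add: mat_of_rows_index)
  qed (use len N in auto)
  then show ?thesis
    using det_mult[OF E N] len by (simp add: levi_civita_rows)
qed

text \<open>The matrix is antidiagonal. In size \<open>Suc n\<close> the only nonzero entry of
  column \<open>0\<close> is a 1 in row \<open>n\<close>, so Laplace expansion there gives the
  factor \<open>(-1) ^ n\<close> and the antidiagonal matrix of size \<open>n\<close>.\<close>

lemma levi_civita_rev_upt: "levi_civita n (rev [0..<n]) = ((-1) ^ (n div 2) :: 'a :: comm_ring_1)"
proof (induction n)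
  case 0
  show ?case by (simp add: levi_civita_def det_def)
next
  case (Suc n)
  let ?B = "mat_of_cols (Suc n) (map (unit_vec (Suc n)) (rev [0..<Suc n])) :: 'a mat"
  let ?C = "mat_of_cols n (map (unit_vec n) (rev [0..<n])) :: 'a mat"
  have B: "?B \<in> carrier_mat (Suc n) (Suc n)" by (intro carrier_matI) auto
  have ent: "?B $$ (i, c) = (if i + c = n then 1 else 0)" if "i < Suc n" "c < Suc n" for i c
    using that by (auto simp: mat_of_cols_index rev_nth simp del: upt_Suc)
  have "mat_delete ?B n 0 = ?C"
  proof (rule eq_matI)
    fix i c assume "i < dim_row ?C" "c < dim_col ?C"
    then have ic: "i < n" "c < n" by auto
    then have "mat_delete ?B n 0 $$ (i, c) = ?B $$ (i, Suc c)"
      by (simp add: mat_delete_def del: upt_Suc)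
    also have "\<dots> = ?C $$ (i, c)"
      using ic by (subst ent) (auto simp: mat_of_cols_index rev_nth)
    finally show "mat_delete ?B n 0 $$ (i, c) = ?C $$ (i, c)" .
  qed (auto simp: mat_delete_def)
  then have cof: "cofactor ?B n 0 = (-1) ^ n * levi_civita n (rev [0..<n])"
    by (simp add: cofactor_def levi_civita_def del: upt_Suc)
  have "det ?B = (\<Sum>i<Suc n. ?B $$ (i, 0) * cofactor ?B i 0)"
    by (rule laplace_expansion_column[OF B]) simp
  also have "\<dots> = (\<Sum>i<Suc n. if i = n then cofactor ?B i 0 else 0)"
    by (intro sum.cong refl) (simp add: ent del: upt_Suc)
  also have "\<dots> = (-1) ^ n * (-1) ^ (n div 2)"
    using cof Suc.IH by (simp del: upt_Suc)
  \<comment> \<open>\<open>n + n div 2\<close> and \<open>Suc n div 2\<close> have the same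
    parity.\<close>
  also have "\<dots> = (-1) ^ (Suc n div 2)"
    by (cases "even n") (auto elim!: evenE oddE simp: power_add)
  finally show ?case by (simp add: levi_civita_def del: upt_Suc)
qed

text \<open>Reversing \<open>J\<close> selects the rows of the matrix of \<open>J\<close> along
  \<open>rev [0..<n]\<close>, so the sign does not depend on \<open>J\<close> and is that of the
  antidiagonal matrix.\<close>

lemma levi_civita_rev:
  assumes J: "J \<in> multi_idx n n"
  shows "levi_civita n (rev J) = ((-1) ^ (n div 2) * levi_civita n J :: 'a :: comm_ring_1)"
proof -
  have len: "length J = n" using J by (simp add: multi_idx_def)
  let ?E = "mat_of_rows n (map (unit_vec n) J) :: 'a mat"
  have E: "?E \<in> carrier_mat n n" using len by (intro carrier_matI) auto
  have "rev [0..<n] \<in> multi_idx n n" by (auto simp: multi_idx_def)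
  from det_rows_reindex[OF E this]
  have "det (mat_of_rows n (map (row ?E) (rev [0..<n]))) = (-1) ^ (n div 2) * levi_civita n J"
    using len by (simp add: levi_civita_rev_upt levi_civita_rows)
  moreover have "map (row ?E) [0..<n] = map (unit_vec n) J"
    using len by (intro nth_equalityI) auto
  then have "map (row ?E) (rev [0..<n]) = map (unit_vec n) (rev J)"
    by (simp flip: rev_map)
  ultimately show ?thesis using len by (simp add: levi_civita_rows)
qed

lemma levi_civita_not_distinct:
  assumes "length J = n" "\<not> distinct J"
  shows "levi_civita n J = (0 :: 'a :: idom)"
proof -
  obtain a c where ac: "a < n" "c < n" "a \<noteq> c" "J ! a = J ! c"
    using assms by (auto simp: distinct_conv_nth)
  let ?E = "mat_of_cols n (map (unit_vec n) J) :: 'a mat"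
  have "?E \<in> carrier_mat n n" using assms by (intro carrier_matI) auto
  moreover have "col ?E a = col ?E c" using ac assms(1) by simp
  ultimately show ?thesis
    unfolding levi_civita_def using det_identical_columns ac by blast
qed

text \<open>The square is the determinant of the Gram matrix of the vectors indexed by
  \<open>J\<close>, which are orthonormal when \<open>J\<close> has no repetitions.\<close>

lemma levi_civita_square_distinct:
  assumes J: "J \<in> multi_idx n n" and "distinct J"
  shows "levi_civita n J * levi_civita n J = (1 :: 'a :: comm_ring_1)"
proof -
  have len: "length J = n" and sub: "\<And>i. i < n \<Longrightarrow> J ! i < n"
    using J nth_mem by (auto simp: multi_idx_def)
  let ?R = "mat_of_rows n (map (unit_vec n) J) :: 'a mat"
  let ?C = "mat_of_cols n (map (unit_vec n) J) :: 'a mat"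
  have R: "?R \<in> carrier_mat n n" and C: "?C \<in> carrier_mat n n"
    using len by (auto intro!: carrier_matI)
  have "?R * ?C = 1\<^sub>m n"
    using len sub \<open>distinct J\<close>
    by (intro eq_matI) (auto simp: nth_eq_iff_index_eq)
  then show ?thesis
    using det_mult[OF R C] len by (simp add: levi_civita_rows[symmetric] levi_civita_def[symmetric])
qed

text \<open>A term is 1 if \<open>I\<close> is an arrangement of the \<open>n - 1\<close> indices
  other than \<open>i\<close>, and 0 otherwise.\<close>

lemma sum_levi_civita_square:
  assumes "i < n"
  shows "(\<Sum>I\<in>multi_idx n (n - 1). levi_civita n (I @ [i]) * levi_civita n (I @ [i]))
    = (fact (n - 1) :: 'a :: {idom, semiring_char_0})"
proof -
  let ?D = "{I. length I = n - 1 \<and> distinct I \<and> set I \<subseteq> {..<n} - {i}}"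
  have "(\<Sum>I\<in>multi_idx n (n - 1). levi_civita n (I @ [i]) * levi_civita n (I @ [i]))
    = (\<Sum>I\<in>multi_idx n (n - 1). if I \<in> ?D then 1 else (0 :: 'a))"
  proof (rule sum.cong[OF refl])
    fix I assume I: "I \<in> multi_idx n (n - 1)"
    then have Ii: "I @ [i] \<in> multi_idx n n" using assms by (auto simp: multi_idx_def)
    then have "length (I @ [i]) = n" by (simp add: multi_idx_def)
    moreover have "distinct (I @ [i]) \<longleftrightarrow> I \<in> ?D" using I by (auto simp: multi_idx_def)
    ultimately show "levi_civita n (I @ [i]) * levi_civita n (I @ [i])
      = (if I \<in> ?D then 1 else (0 :: 'a))"
      using levi_civita_square_distinct[OF Ii] levi_civita_not_distinct[of "I @ [i]" n]
      by auto
  qed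
  also have "\<dots> = of_nat (card (multi_idx n (n - 1) \<inter> ?D))"
    by (simp add: sum.If_cases finite_multi_idx)
  also have "multi_idx n (n - 1) \<inter> ?D = ?D" by (auto simp: multi_idx_def)
  \<comment> \<open>Lists of length \<open>n - 1\<close> are drawn from a set of
    \<open>n - 1\<close> elements, so the falling factorial starts at 1 and is a full
    factorial.\<close>
  also have "card ?D = \<Prod>{card ({..<n} - {i}) - (n - 1) + 1..card ({..<n} - {i})}"
    by (rule card_lists_distinct_length_eq) (use assms in auto)
  also have "\<dots> = fact (n - 1)" using assms by (simp add: fact_prod)
  finally show ?thesis by simp
qed

section \<open>Cofactors from selected rows\<close>

lemma det_replace_row_unit_vec:
  fixes M :: "'a :: comm_ring_1 mat"
  assumes M: "M \<in> carrier_mat n n" and "i < n" "j < n"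
  shows "det (mat n n (\<lambda>(r, c). if r = i then unit_vec n j $ c else M $$ (r, c))) = cofactor M i j"
    (is "det ?N = _")
proof -
  have N: "?N \<in> carrier_mat n n" by simp
  \<comment> \<open>The only altered row is the one deleted.\<close>
  have "mat_delete ?N i j = mat_delete M i j"
    using M assms(2,3) by (intro eq_matI) (auto simp: mat_delete_def)
  then have cof: "cofactor ?N i j = cofactor M i j" by (simp add: cofactor_def)
  have "det ?N = (\<Sum>c<n. ?N $$ (i, c) * cofactor ?N i c)"
    by (rule laplace_expansion_row[OF N \<open>i < n\<close>])
  also have "\<dots> = (\<Sum>c<n. if c = j then cofactor ?N i c else 0)"
    by (intro sum.cong refl) (use assms in auto)
  finally show ?thesis using cof \<open>j < n\<close> by simp
qed

text \<open>The common factor \<open>levi_civita n (I @ [i])\<close> eliminates the lists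
  \<open>I\<close> that contain \<open>i\<close>, for which the determinant on the left need not
  vanish.\<close>

lemma levi_civita_times_det_rows:
  fixes M :: "'a :: idom mat"
  assumes M: "M \<in> carrier_mat n n" and i: "i < n" and j: "j < n"
    and I: "I \<in> multi_idx n (n - 1)"
  shows "levi_civita n (I @ [i]) * det (mat_of_rows n (map (row M) I @ [unit_vec n j]))
    = levi_civita n (I @ [i]) * levi_civita n (I @ [i]) * cofactor M i j"
proof (cases "distinct (I @ [i])")
  case False
  then have "levi_civita n (I @ [i]) = (0 :: 'a)"
    using I i by (intro levi_civita_not_distinct) (auto simp: multi_idx_def)
  then show ?thesis by simp
next
  case True
  \<comment> \<open>Since \<open>i\<close> is not in \<open>I\<close>, the rows of \<open>N\<close>
    along \<open>I @ [i]\<close> are exactly those of the determinant on the left.\<close>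
  define N where "N = mat n n (\<lambda>(r, c). if r = i then unit_vec n j $ c else M $$ (r, c))"
  have N: "N \<in> carrier_mat n n" by (simp add: N_def)
  have "I @ [i] \<in> multi_idx n n" using I i by (auto simp: multi_idx_def)
  note * = det_rows_reindex[OF N this]
  have "row N r = row M r" if "r \<in> set I" for r
    using that True I M by (intro eq_vecI) (auto simp: N_def multi_idx_def subset_iff)
  then have rows: "map (row N) I = map (row M) I" by simp
  have "row N i = unit_vec n j" using i by (intro eq_vecI) (auto simp: N_def)
  then have "det (mat_of_rows n (map (row M) I @ [unit_vec n j]))
      = levi_civita n (I @ [i]) * cofactor M i j"
    using * det_replace_row_unit_vec[OF M i j] by (simp add: rows flip: N_def)
  then show ?thesis by (simp add: mult.assoc)
qed

text \<open>Expanding \<open>v\<close> in the standard basis puts \<open>i\<close> in front of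
  \<open>rev I\<close>, which is the reversal of \<open>I @ [i]\<close>.\<close>

lemma det_cols_Cons_unit_vecs:
  assumes v: "v \<in> carrier_vec n" and "n \<ge> 1" and I: "I \<in> multi_idx n (n - 1)"
  shows "det (mat_of_cols n (v # map (unit_vec n) (rev I)))
    = (-1) ^ (n div 2) * (\<Sum>i<n. v $ i * (levi_civita n (I @ [i]) :: complex))"
proof -
  have "multilinear n 1 (\<lambda>vs. det (mat_of_cols n (vs @ map (unit_vec n) (rev I))))"
    using assms by (intro multilinear_det_cols) (auto simp: multi_idx_def)
  then have "det (mat_of_cols n (([] @ v # []) @ map (unit_vec n) (rev I)))
    = (\<Sum>i<n. v $ i * det (mat_of_cols n (([] @ unit_vec n i # []) @ map (unit_vec n) (rev I))))"
    unfolding multilinear_def using v by auto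
  then have "det (mat_of_cols n (v # map (unit_vec n) (rev I)))
    = (\<Sum>i<n. v $ i * levi_civita n (rev (I @ [i])))"
    by (simp add: levi_civita_def)
  also have "\<dots> = (\<Sum>i<n. v $ i * ((-1) ^ (n div 2) * levi_civita n (I @ [i])))"
    using I \<open>n \<ge> 1\<close>
    by (intro sum.cong refl arg_cong2[where f = "(*)"] levi_civita_rev)
       (auto simp: multi_idx_def)
  finally show ?thesis by (simp add: sum_distrib_left mult_ac)
qed

section \<open>Evaluation of the diagram as a sum of products of two determinants\<close>

lemma lin_ext_sum:
  "lin_ext n k F (\<lambda>L. \<Sum>I\<in>S. c I * t I L) = (\<lambda>L. \<Sum>I\<in>S. c I * lin_ext n k F (t I) L)"
  unfolding lin_ext_def
  by (rule ext, simp add: sum_distrib_left sum_distrib_right mult.assoc, rule sum.swap)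

lemma R_map_unit_vec:
  assumes "M \<in> carrier_mat n n" "i < n"
  shows "R_map M (unit_vec n i) = row M i"
  using assms by (intro eq_vecI) (auto simp: R_map_def)

lemma S_map_pure_tensor_codim_1:
  assumes "n \<ge> 1" "set ws \<subseteq> carrier_vec n" "length ws = n - 1" "j < n"
  shows "S_map n (n - 1) (pure_tensor n ws) [j] = det (mat_of_rows n (ws @ [unit_vec n j]))"
proof -
  have "S_map n (n - 1) (pure_tensor n ws) [j] = (\<Sum>I\<in>multi_idx n (Suc 0).
    det (mat_of_rows n (ws @ map (unit_vec n) (rev I))) * pure_tensor n (map (unit_vec n) I) [j])"
    using assms by (subst S_map_pure_tensor) auto
  also have "\<dots> = (\<Sum>i<n. if i = j then det (mat_of_rows n (ws @ [unit_vec n i])) else 0)"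
    unfolding sum_multi_idx_Suc multi_idx_0
    by (intro sum.cong refl) (use \<open>j < n\<close> in \<open>auto simp: pure_tensor_def multi_idx_def\<close>)
  finally show ?thesis using \<open>j < n\<close> by simp
qed

lemma diagram_value:
  assumes n: "n \<ge> 1" and M: "M \<in> carrier_mat n n" and v: "v \<in> carrier_vec n" and j: "j < n"
  shows "(S_map n (n - 1) \<circ> tensor_power n (n - 1) (R_map M) \<circ> T_map n 1) (vec_to_tensor n v) [j]
    = (\<Sum>I\<in>multi_idx n (n - 1). det (mat_of_cols n (v # map (unit_vec n) (rev I)))
        * det (mat_of_rows n (map (row M) I @ [unit_vec n j])))"
proof -
  have val: "S_map n (n - 1) (tensor_power n (n - 1) (R_map M) (pure_tensor n (map (unit_vec n) I))) [j]
    = det (mat_of_rows n (map (row M) I @ [unit_vec n j]))" if I: "I \<in> multi_idx n (n - 1)" for I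
  proof -
    have "map (R_map M) (map (unit_vec n) I) = map (row M) I"
      using I R_map_unit_vec[OF M] by (auto simp: multi_idx_def subset_iff)
    moreover have "tensor_power n (n - 1) (R_map M) (pure_tensor n (map (unit_vec n) I))
      = pure_tensor n (map (R_map M) (map (unit_vec n) I))"
      by (rule tensor_power_R_map_pure_tensor[OF M]) (use I in \<open>auto simp: multi_idx_def\<close>)
    moreover have "S_map n (n - 1) (pure_tensor n (map (row M) I)) [j]
      = det (mat_of_rows n (map (row M) I @ [unit_vec n j]))"
      using I M n j by (intro S_map_pure_tensor_codim_1) (auto simp: multi_idx_def)
    ultimately show ?thesis by (simp only:)
  qed
  have T: "T_map n 1 (vec_to_tensor n v) = (\<lambda>L. \<Sum>I\<in>multi_idx n (n - 1).
    det (mat_of_cols n (v # map (unit_vec n) (rev I))) * pure_tensor n (map (unit_vec n) I) L)"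
    unfolding vec_to_tensor_def using n v by (subst T_map_pure_tensor) auto
  show ?thesis
    \<comment> \<open>\<open>lin_ext_sum\<close> moves the sum produced by the sink vertex outward
      through both later maps, leaving pure tensors of basis vectors.\<close>
    unfolding o_apply T tensor_power_def S_map_def lin_ext_sum
    by (intro sum.cong refl arg_cong2[where f = "(*)"]
        val[unfolded tensor_power_def S_map_def])
qed

theorem proposition6p2:
  fixes n j :: nat and A A\<^sub>j :: "complex mat" and x b :: "complex vec"
  assumes "n \<ge> 1"
    and "A \<in> carrier_mat n n"
    and "x \<in> carrier_vec n"
    and "b = A *\<^sub>v x"
    and "j < n"
    and "A\<^sub>j = replace_col A b j"
  shows "tensor_to_vec n
           ((S_map n (n - 1) \<circ> tensor_power n (n - 1) (R_map A\<^sub>j) \<circ> T_map n 1)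
             (vec_to_tensor n (A\<^sub>j *\<^sub>v unit_vec n j))) $ j
         = (-1) ^ (n div 2) * fact (n - 1) * det A * x $ j"
proof -
  have M: "A\<^sub>j \<in> carrier_mat n n"
    using assms(2) by (simp add: assms(6) replace_col_def)
  define v where "v = A\<^sub>j *\<^sub>v unit_vec n j"
  have v: "v \<in> carrier_vec n" using M by (simp add: v_def)
  \<comment> \<open>\<open>v\<close> is column \<open>j\<close> of \<open>A\<^sub>j\<close>; its
    coordinates later supply the entries of the Laplace expansion along that column.\<close>
  have vi: "v $ i = A\<^sub>j $$ (i, j)" if "i < n" for i
    using that M assms(5) by (simp add: v_def)
  let ?\<epsilon> = "\<lambda>I i. levi_civita n (I @ [i]) :: complex"
  let ?D = "\<lambda>I. det (mat_of_rows n (map (row A\<^sub>j) I @ [unit_vec n j]))"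
  have "tensor_to_vec n ((S_map n (n - 1) \<circ> tensor_power n (n - 1) (R_map A\<^sub>j) \<circ> T_map n 1)
      (vec_to_tensor n v)) $ j
    = (\<Sum>I\<in>multi_idx n (n - 1). det (mat_of_cols n (v # map (unit_vec n) (rev I))) * ?D I)"
    unfolding tensor_to_vec_def index_vec[OF \<open>j < n\<close>]
    by (rule diagram_value[OF assms(1) M v assms(5)])
  also have "\<dots> = (\<Sum>I\<in>multi_idx n (n - 1). (-1) ^ (n div 2) * (\<Sum>i<n. v $ i * (?\<epsilon> I i * ?D I)))"
    by (intro sum.cong refl)
       (simp add: det_cols_Cons_unit_vecs[OF v assms(1)] sum_distrib_right mult.assoc)
  also have "\<dots> = (\<Sum>I\<in>multi_idx n (n - 1). (-1) ^ (n div 2) *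
      (\<Sum>i<n. A\<^sub>j $$ (i, j) * (?\<epsilon> I i * ?\<epsilon> I i * cofactor A\<^sub>j i j)))"
    by (intro sum.cong refl arg_cong2[where f = "(*)"] levi_civita_times_det_rows[OF M _ assms(5)])
       (auto simp: vi)
  \<comment> \<open>With \<open>i\<close> fixed, the entry and the cofactor are constant in
    \<open>I\<close>, and only the sum of squares remains inside.\<close>
  also have "\<dots> = (-1) ^ (n div 2) * (\<Sum>i<n. \<Sum>I\<in>multi_idx n (n - 1).
      A\<^sub>j $$ (i, j) * (?\<epsilon> I i * ?\<epsilon> I i * cofactor A\<^sub>j i j))"
    by (subst sum.swap) (simp add: sum_distrib_left)
  also have "\<dots> = (-1) ^ (n div 2) * (\<Sum>i<n. A\<^sub>j $$ (i, j) * (fact (n - 1) * cofactor A\<^sub>j i j))"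
    by (simp add: sum_levi_civita_square del: One_nat_def flip: sum_distrib_left sum_distrib_right)
  also have "\<dots> = (-1) ^ (n div 2) * fact (n - 1) * det A\<^sub>j"
    by (simp add: laplace_expansion_column[OF M assms(5)] sum_distrib_left mult_ac)
  \<comment> \<open>This form of Cramer's rule covers singular \<open>A\<close> as well.\<close>
  also have "det A\<^sub>j = x $ j * det A"
    using cramer_lemma_mat[OF assms(2,3,5)] assms(4,6) by simp
  finally show ?thesis by (simp add: v_def mult_ac)
qed

end
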